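(* Let $f,g:\mathbb{R}^n\to\mathbb{R}^n$ satisfy $f(0)=g(0)=0$, with $g$ differentiable, and suppose: (a) (local Lipschitz condition) for each $j>0$ there is $K_j>0$ such that $\max\{|f(x)-f(y)|,|g(x)-g(y)|\}\le K_j|x-y|$ for all $x,y\in\mathbb{R}^n$ with $\max\{|x|,|y|\}\le j$; (b) there is $\gamma>0$ such that $2x^Tf(x)+|g(x)|^2\le-\gamma|x|^2$ for all $x\in\mathbb{R}^n$; (c) there is a constant $\sigma$ such that $|L^1g(x)|^2\le\sigma|x|^2$ for all $x\in\mathbb{R}^n$; (d) there is $\mu\in\mathbb{R}$ such that $\langle x-y,f(x)-f(y)\rangle\le\mu|x-y|^2$ for all $x,y\in\mathbb{R}^n$. Let $\theta\in[0,1]$, $x_0\in\mathbb{R}^n$, and let $\Delta^*:=\frac1{\mu\theta}$ if $\theta\in(0,1]$ and $\mu>0$, and $\Delta^*:=\infty$ if $\theta=0$ or $\mu\le0$. Let $\{z_k\}$ and $\{y_k\}$ be the split-step theta-Milstein and stochastic theta-Milstein approximations with stepsize $\Delta>0$ and $y_0=x_0$. Then there is a positive constant $C(x_0)$, dependent on the initial data $x_0$ and independent of the stepsize $\Delta$ and of $k$, such that the following hold. (i) Let $\theta\in[0,1/2]$. If there is a constant $K>0$ such that $|f(x)|^2\le K|x|^2$ for all $x\in\mathbb{R}^n$, then for any $\Delta<\Delta_1^*:=\min\Big\{\dfrac{\gamma}{(1-2\theta)K+0.5\sigma},\,\Delta^*\Big\}$ and any integer $k\ge1$, $$\mathbb{E}|z_k|^2\le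 C(x_0)e^{-\gamma_\Delta k\Delta}\quad\text{and}\quad \mathbb{E}|y_k|^2\le C(x_0)e^{-\gamma_\Delta k\Delta},$$ where $\gamma_\Delta=-\dfrac1\Delta\log\Big(1-\dfrac{\gamma-(1-2\theta)K\Delta-0.5\sigma\Delta}{(1+\theta\Delta\sqrt K)^2}\Delta\Big)$. (ii) Let $\theta\in(1/2,1]$. Then for any $\Delta<\Delta_2^*:=\min\Big\{\dfrac{2\gamma}{\sigma},\,\Delta^*\Big\}$ and any integer $k\ge1$, $$\mathbb{E}|z_k|^2\le C(x_0)e^{-\gamma_\Delta k\Delta}\quad\text{and}\quad \mathbb{E}|y_k|^2\le C(x_0)e^{-\gamma_\Delta k\Delta},$$ where $\gamma_\Delta=-\dfrac1\Delta\log\Big(1-\dfrac{(2\theta-1)(\gamma-0.5\sigma\Delta)\Delta}{2\theta-1+(\gamma-0.5\sigma\Delta)\Delta\theta^2}\Big)$.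
   Context: $|\cdot|$ is the Euclidean norm and $\langle x,y\rangle=x^Ty$ on $\mathbb{R}^n$. $(w(t))_{t\ge0}$ is a one-dimensional Brownian motion on a complete filtered probability space satisfying the usual conditions. The underlying SDE is $dx(t)=f(x(t))dt+g(x(t))dw(t)$, $x(0)=x_0\in\mathbb{R}^n$. Here $L^1=g(x)\frac{\partial}{\partial x}$, i.e. $L^1g(x)=g'(x)g(x)=\sum_{i=1}^n g^i(x)\frac{\partial g}{\partial x^i}(x)\in\mathbb{R}^n$. For $\theta\in[0,1]$, a stepsize $\Delta>0$ with $\theta\mu\Delta<1$ and $\Delta w_k:=w((k+1)\Delta)-w(k\Delta)$, set $y_0=x_0$, $z_0=y_0-\theta f(y_0)\Delta$ and, for $k=0,1,2,\dots$, $$z_{k+1}=z_k+f(y_k)\Delta+g(y_k)\Delta w_k+\tfrac12L^1g(y_k)\big(|\Delta w_k|^2-\Delta\big),\qquad y_{k}=z_{k}+\theta f(y_{k})\Delta,$$ where, for each $k$, $y_k$ is the unique solution $y$ of $y=z_k+\theta\Delta f(y)$ (uniquely solvable by the one-sided Lipschitz condition (d) and $\theta\mu\Delta<1$). $\{z_k\}$ is called the split-step theta-Milstein (SSTM) approximation and $\{y_k\}$ the stochastic theta-Milstein (STM) approximation. Conventions: a quotient with positive numerator and zero denominator is read as $\infty$; if $\gamma_\Delta=-\frac1\Delta\log\rho$ then $e^{-\gamma_\Delta k\Delta}$ means $\rho^k$ (also if $\rho=0$).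
   Formalization: When the stepsize threshold is infinite, the bound on E|z_k|² is proved with C uniform only over each bounded range of Δ; with C independent of all Δ>0 it is false (f(x)=-x, g=0, σ=0: z_1=(1-(1-θ)Δ)x_0). The bound on y_k, and all finite-threshold cases, are as stated. *)

theory Defs
  imports "HOL-Analysis.Analysis" "HOL-Probability.Probability"
begin

section \<open>Filtered probability spaces and Brownian motion\<close>

locale usual_filtered_prob_space = prob_space M + complete_measure M
  for M :: "'a measure" +
  fixes F :: "real \<Rightarrow> 'a measure"
  assumes subalgebra_F: "\<And>t. 0 \<le> t \<Longrightarrow> subalgebra M (F t)"
    and F_mono: "\<And>s t. 0 \<le> s \<Longrightarrow> s \<le> t \<Longrightarrow> sets (F s) \<subseteq> sets (F t)"
    and F_right_continuous: "\<And>t. 0 \<le> t \<Longrightarrow> sets (F t) = (\<Inter>s\<in>{t<..}. sets (F s))"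
    and F_complete: "null_sets M \<subseteq> sets (F 0)"

locale brownian_motion = usual_filtered_prob_space M F
  for M :: "'a measure" and F :: "real \<Rightarrow> 'a measure" +
  fixes w :: "real \<Rightarrow> 'a \<Rightarrow> real"
  assumes adapted: "\<And>t. 0 \<le> t \<Longrightarrow> w t \<in> borel_measurable (F t)"
    and start: "AE \<omega> in M. w 0 \<omega> = 0"
    and continuous_paths: "AE \<omega> in M. continuous_on {0..} (\<lambda>t. w t \<omega>)"
    and gaussian_increments: "\<And>s t. 0 \<le> s \<Longrightarrow> s < t \<Longrightarrow>
      distributed M lborel (\<lambda>\<omega>. w t \<omega> - w s \<omega>) (normal_density 0 (sqrt (t - s)))"
    and independent_increments: "\<And>s t. 0 \<le> s \<Longrightarrow> s < t \<Longrightarrow>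
      indep_set (sets (F s)) {(\<lambda>\<omega>. w t \<omega> - w s \<omega>) -` B \<inter> space M | B. B \<in> sets borel}"

section \<open>The theta-Milstein schemes\<close>

definition L1 :: "(real^'n \<Rightarrow> real^'n) \<Rightarrow> (real^'n \<Rightarrow> real^'n) \<Rightarrow> real^'n \<Rightarrow> real^'n" where
  "L1 g h x = frechet_derivative h (at x) (g x)"

lemma L1_eq_sum_partial:
  assumes "h differentiable (at x)"
  shows "L1 g h x = (\<Sum>i\<in>UNIV. (g x $ i) *\<^sub>R frechet_derivative h (at x) (axis i 1))"
proof -
  have lin: "linear (frechet_derivative h (at x))"
    using assms by (rule linear_frechet_derivative)
  have "g x = (\<Sum>i\<in>UNIV. (g x $ i) *\<^sub>R axis i 1)"
    using basis_expansion[of "g x"] by (simp add: scalar_mult_eq_scaleR)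
  then have "L1 g h x = frechet_derivative h (at x) (\<Sum>i\<in>UNIV. (g x $ i) *\<^sub>R axis i 1)"
    unfolding L1_def by simp
  also have "\<dots> = (\<Sum>i\<in>UNIV. (g x $ i) *\<^sub>R frechet_derivative h (at x) (axis i 1))"
    by (simp add: linear_sum[OF lin] linear_scale[OF lin])
  finally show ?thesis .
qed

text \<open>Solution operator of the implicit equation with step \<open>h\<close>, to be used with
  \<open>h = \<theta> * \<Delta>\<close>. The description is meaningful when the solution is unique; uniqueness under
  the one-sided Lipschitz condition and \<open>\<mu> * h < 1\<close> is \<open>implicit_solution_unique\<close> below.\<close>

definition implicit_solution :: "(real^'n \<Rightarrow> real^'n) \<Rightarrow> real \<Rightarrow> real^'n \<Rightarrow> real^'n" where
  "implicit_solution f h z = (THE y. y = z + h *\<^sub>R f y)"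

text \<open>\<open>sstm\<close> is the split-step sequence \<open>z\<close> and \<open>stm\<close> the sequence \<open>y\<close>.\<close>

primrec sstm :: "(real^'n \<Rightarrow> real^'n) \<Rightarrow> (real^'n \<Rightarrow> real^'n) \<Rightarrow> real \<Rightarrow> real^'n
    \<Rightarrow> (real \<Rightarrow> 'a \<Rightarrow> real) \<Rightarrow> real \<Rightarrow> nat \<Rightarrow> 'a \<Rightarrow> real^'n" where
  "sstm f g \<theta> x0 w \<Delta> 0 = (\<lambda>\<omega>. x0 - (\<theta> * \<Delta>) *\<^sub>R f x0)"
| "sstm f g \<theta> x0 w \<Delta> (Suc k) = (\<lambda>\<omega>.
     let z = sstm f g \<theta> x0 w \<Delta> k \<omega>;
         y = implicit_solution f (\<theta> * \<Delta>) z;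
         dw = w (real (Suc k) * \<Delta>) \<omega> - w (real k * \<Delta>) \<omega>
     in z + \<Delta> *\<^sub>R f y + dw *\<^sub>R g y + ((1 / 2) * (\<bar>dw\<bar>\<^sup>2 - \<Delta>)) *\<^sub>R L1 g g y)"

definition stm :: "(real^'n \<Rightarrow> real^'n) \<Rightarrow> (real^'n \<Rightarrow> real^'n) \<Rightarrow> real \<Rightarrow> real^'n
    \<Rightarrow> (real \<Rightarrow> 'a \<Rightarrow> real) \<Rightarrow> real \<Rightarrow> nat \<Rightarrow> 'a \<Rightarrow> real^'n" where
  "stm f g \<theta> x0 w \<Delta> k \<omega> = implicit_solution f (\<theta> * \<Delta>) (sstm f g \<theta> x0 w \<Delta> k \<omega>)"

lemma implicit_solution_unique:
  fixes f :: "real^'n \<Rightarrow> real^'n"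
  assumes osl: "\<And>x y. (x - y) \<bullet> (f x - f y) \<le> \<mu> * (norm (x - y))\<^sup>2"
    and h: "0 \<le> h" "\<mu> * h < 1"
    and y: "y = z + h *\<^sub>R f y" and y': "y' = z + h *\<^sub>R f y'"
  shows "y = y'"
proof -
  have "y - y' = h *\<^sub>R (f y - f y')"
    by (subst y, subst y') (simp add: scaleR_diff_right)
  then have "(norm (y - y'))\<^sup>2 = (y - y') \<bullet> (h *\<^sub>R (f y - f y'))"
    by (metis power2_norm_eq_inner)
  also have "\<dots> \<le> h * (\<mu> * (norm (y - y'))\<^sup>2)"
    using mult_left_mono[OF osl[of y y'] h(1)] by simp
  finally have "(1 - \<mu> * h) * (norm (y - y'))\<^sup>2 \<le> 0"
    by (simp add: algebra_simps)
  with h(2) have "(norm (y - y'))\<^sup>2 \<le> 0"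
    by (simp add: mult_le_0_iff)
  then show ?thesis by simp
qed

lemma stm_0:
  fixes f :: "real^'n \<Rightarrow> real^'n"
  assumes "\<And>x y. (x - y) \<bullet> (f x - f y) \<le> \<mu> * (norm (x - y))\<^sup>2"
    and "0 \<le> \<theta> * \<Delta>" "\<mu> * (\<theta> * \<Delta>) < 1"
  shows "stm f g \<theta> x0 w \<Delta> 0 \<omega> = x0"
  unfolding stm_def implicit_solution_def sstm.simps
proof (rule the_equality)
  show "x0 = x0 - (\<theta> * \<Delta>) *\<^sub>R f x0 + (\<theta> * \<Delta>) *\<^sub>R f x0" by simp
  then show "y = x0" if "y = x0 - (\<theta> * \<Delta>) *\<^sub>R f x0 + (\<theta> * \<Delta>) *\<^sub>R f y" for y
    using implicit_solution_unique[OF assms that] by simp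
qed

section \<open>Stepsize thresholds and decay factors\<close>

definition Delta_star :: "real \<Rightarrow> real \<Rightarrow> ereal" where
  "Delta_star \<mu> \<theta> = (if 0 < \<theta> \<and> 0 < \<mu> then ereal (1 / (\<mu> * \<theta>)) else \<infinity>)"

text \<open>Division on \<open>ereal\<close> satisfies \<open>ereal a / 0 = \<infinity>\<close> for \<open>a > 0\<close>.\<close>

definition Delta1_star :: "real \<Rightarrow> real \<Rightarrow> real \<Rightarrow> real \<Rightarrow> real \<Rightarrow> ereal" where
  "Delta1_star \<gamma> \<sigma> \<mu> K \<theta> =
     min (ereal \<gamma> / ereal ((1 - 2 * \<theta>) * K + 0.5 * \<sigma>)) (Delta_star \<mu> \<theta>)"

definition Delta2_star :: "real \<Rightarrow> real \<Rightarrow> real \<Rightarrow> real \<Rightarrow> ereal" where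
  "Delta2_star \<gamma> \<sigma> \<mu> \<theta> = min (ereal (2 * \<gamma>) / ereal \<sigma>) (Delta_star \<mu> \<theta>)"

definition rho1 :: "real \<Rightarrow> real \<Rightarrow> real \<Rightarrow> real \<Rightarrow> real \<Rightarrow> real" where
  "rho1 \<gamma> \<sigma> K \<theta> \<Delta> =
     1 - (\<gamma> - (1 - 2 * \<theta>) * K * \<Delta> - 0.5 * \<sigma> * \<Delta>) / (1 + \<theta> * \<Delta> * sqrt K)\<^sup>2 * \<Delta>"

definition rho2 :: "real \<Rightarrow> real \<Rightarrow> real \<Rightarrow> real \<Rightarrow> real" where
  "rho2 \<gamma> \<sigma> \<theta> \<Delta> =
     1 - ((2 * \<theta> - 1) * (\<gamma> - 0.5 * \<sigma> * \<Delta>) * \<Delta>)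
           / (2 * \<theta> - 1 + (\<gamma> - 0.5 * \<sigma> * \<Delta>) * \<Delta> * \<theta>\<^sup>2)"

text \<open>With the rate \<open>\<gamma>\<^sub>\<Delta> = decay_rate \<Delta> \<rho>\<close>, the factor \<open>exp (- \<gamma>\<^sub>\<Delta> k \<Delta>)\<close> is the power
  \<open>\<rho> ^ k\<close>. Bounds are stated with the power because \<open>rho1\<close> may vanish (rate \<open>+\<infinity>\<close>), whereas
  \<open>ln 0 = 0\<close> on type \<open>real\<close>.\<close>

definition decay_rate :: "real \<Rightarrow> real \<Rightarrow> real" where
  "decay_rate \<Delta> \<rho> = - (1 / \<Delta>) * ln \<rho>"

lemma exp_decay_rate:
  assumes "0 < \<Delta>" "0 < \<rho>"
  shows "exp (- decay_rate \<Delta> \<rho> * real k * \<Delta>) = \<rho> ^ k"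
proof -
  have "- decay_rate \<Delta> \<rho> * real k * \<Delta> = real k * ln \<rho>"
    using assms by (simp add: decay_rate_def)
  then show ?thesis
    using assms by (simp add: exp_of_nat_mult)
qed

text \<open>Integrability is part of the bound, since the Bochner integral of a non-integrable
  function is 0.\<close>

definition second_moment_le :: "'a measure \<Rightarrow> ('a \<Rightarrow> real^'n) \<Rightarrow> real \<Rightarrow> bool" where
  "second_moment_le M X b \<longleftrightarrow>
     integrable M (\<lambda>\<omega>. (norm (X \<omega>))\<^sup>2) \<and> (\<integral>\<omega>. (norm (X \<omega>))\<^sup>2 \<partial>M) \<le> b"

text \<open>The constant in the bound on \<open>sstm\<close> can be uniform over all admissible stepsizes only if
  these are bounded. For \<open>f x = - x\<close>, \<open>g = 0\<close>, \<open>\<gamma> = 2\<close>, \<open>\<sigma> = 0\<close>, \<open>\<mu> = -1\<close> every \<open>\<Delta> > 0\<close> is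
  admissible, and \<open>sstm\<close> at \<open>k = 1\<close> is \<open>(1 - (1 - \<theta>) * \<Delta>) *\<^sub>R x0\<close>, unbounded in \<open>\<Delta>\<close> if
  \<open>1 / 2 \<le> \<theta> < 1\<close> and \<open>x0 \<noteq> 0\<close>. When the threshold \<open>D\<close> is \<open>\<infinity>\<close>, uniformity of that bound is
  therefore asked for on each bounded range \<open>\<Delta> \<le> \<Delta>max\<close>; a finite \<open>D\<close> imposes no
  restriction.\<close>

definition uniform_range :: "ereal \<Rightarrow> real \<Rightarrow> real \<Rightarrow> bool" where
  "uniform_range D \<Delta>max \<Delta> \<longleftrightarrow> (D = \<infinity> \<longrightarrow> \<Delta> \<le> \<Delta>max)"

end

theory Submission
  imports Defs
begin

text \<open>
  Conditioning on the past, the Gaussian moments of the increment turn one step of the scheme into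
  \<open>|y + (1 - \<theta>) \<Delta> f y|\<^sup>2 + \<Delta> |g y|\<^sup>2 + \<Delta>\<^sup>2 / 2 |L\<^sup>1 g y|\<^sup>2\<close>, where
  \<open>z = y - \<theta> \<Delta> f y\<close>. By dissipativity this is at most
  \<open>|z|\<^sup>2 - (\<gamma> - \<sigma> \<Delta> / 2) \<Delta> |y|\<^sup>2 + (1 - 2 \<theta>) \<Delta>\<^sup>2 |f y|\<^sup>2\<close>, and bounding \<open>|z|\<close> in terms
  of \<open>|y|\<close> and \<open>|f y|\<close> makes it at most \<open>\<rho> |z|\<^sup>2\<close>. Hence the second moment of \<open>z\<^sub>k\<close> decays like
  \<open>\<rho>\<^sup>k\<close>. Testing the implicit equation with \<open>y\<close> gives \<open>|z| \<ge> (1 + \<theta> \<Delta> \<gamma> / 2) |y|\<close>, which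
  transfers the decay to \<open>y\<^sub>k\<close>. The constant does not depend on \<open>K\<close>, since dissipativity forces
  \<open>K \<ge> \<gamma>\<^sup>2 / 4\<close>, so that for \<open>\<theta> < 1 / 2\<close> the stepsizes are bounded independently of \<open>K\<close>.
\<close>

section \<open>Solvability of the implicit equation\<close>

text \<open>Expansiveness gives injectivity, so invariance of domain makes the range open. It also
  pulls Cauchy sequences of images back to Cauchy sequences, so the range is closed. A nonempty
  clopen set fills the connected space.\<close>

lemma expansive_continuous_surj:
  fixes G :: "'a::euclidean_space \<Rightarrow> 'a"
  assumes cont: "continuous_on UNIV G" and c: "0 < c"
    and exp: "\<And>x y. c * norm (x - y) \<le> norm (G x - G y)"
  shows "surj G"
proof -
  have inj: "inj G"
  proof (rule injI)
    fix x y assume "G x = G y"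
    with exp[of x y] c show "x = y" by (simp add: mult_le_0_iff)
  qed
  have "open (range G)"
    using invariance_of_domain[OF cont open_UNIV inj] .
  moreover have "closed (range G)"
    unfolding closed_sequential_limits
  proof (intro allI impI, elim conjE)
    fix u l assume u: "\<forall>n. u n \<in> range G" "u \<longlonglongrightarrow> l"
    then have "\<forall>n. \<exists>x. u n = G x" by blast
    then obtain v where v: "\<And>n. u n = G (v n)" by metis
    have "Cauchy v"
    proof (rule metric_CauchyI)
      fix e :: real assume e: "0 < e"
      have "Cauchy u" using u(2) by (rule LIMSEQ_imp_Cauchy)
      then obtain N where N: "\<forall>m\<ge>N. \<forall>n\<ge>N. dist (u m) (u n) < c * e"
        using metric_CauchyD[of u "c * e"] c e by auto
      have "dist (v m) (v n) < e" if "m \<ge> N" "n \<ge> N" for m n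
      proof -
        have "c * dist (v m) (v n) \<le> dist (u m) (u n)"
          using exp[of "v m" "v n"] by (simp add: dist_norm v)
        also have "\<dots> < c * e" using N that by blast
        finally show ?thesis using c by simp
      qed
      then show "\<exists>N. \<forall>m\<ge>N. \<forall>n\<ge>N. dist (v m) (v n) < e" by blast
    qed
    then obtain a where a: "v \<longlonglongrightarrow> a"
      using Cauchy_convergent convergent_def by blast
    have "isCont G a"
      using cont by (simp add: continuous_on_eq_continuous_at)
    then have "(\<lambda>n. G (v n)) \<longlonglongrightarrow> G a"
      using a by (rule isCont_tendsto_compose)
    with u(2) have "l = G a"
      unfolding v[symmetric] by (rule LIMSEQ_unique)
    then show "l \<in> range G" by simp
  qed
  ultimately show ?thesis
    using clopen[of "range G"] by auto
qed

text \<open>Pair the difference of the images with \<open>x - y\<close>, apply Cauchy-Schwarz and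
  cancel one factor \<open>norm (x - y)\<close>. When \<open>\<mu> * h < 1\<close> the constant is
  positive, which yields both solvability of the implicit equation and Lipschitz continuity of its
  solution.\<close>

lemma one_sided_lipschitz_expansive:
  fixes f :: "real^'n \<Rightarrow> real^'n"
  assumes osl: "\<And>x y. (x - y) \<bullet> (f x - f y) \<le> \<mu> * (norm (x - y))\<^sup>2"
    and h: "0 \<le> h"
  shows "(1 - \<mu> * h) * norm (x - y) \<le> norm ((x - h *\<^sub>R f x) - (y - h *\<^sub>R f y))"
proof (cases "x = y")
  case False
  let ?d = "(x - h *\<^sub>R f x) - (y - h *\<^sub>R f y)"
  have "?d = (x - y) - h *\<^sub>R (f x - f y)"
    by (simp add: scaleR_diff_right)
  then have "(x - y) \<bullet> ?d = (x - y) \<bullet> ((x - y) - h *\<^sub>R (f x - f y))"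
    by (simp only:)
  also have "\<dots> = (norm (x - y))\<^sup>2 - h * ((x - y) \<bullet> (f x - f y))"
    by (simp only: inner_diff_right[of _ "x - y"] inner_scaleR_right power2_norm_eq_inner)
  finally have "(x - y) \<bullet> ?d = (norm (x - y))\<^sup>2 - h * ((x - y) \<bullet> (f x - f y))" .
  moreover have "h * ((x - y) \<bullet> (f x - f y)) \<le> h * (\<mu> * (norm (x - y))\<^sup>2)"
    using osl h by (rule mult_left_mono)
  moreover have "(x - y) \<bullet> ?d \<le> norm (x - y) * norm ?d"
    by (rule norm_cauchy_schwarz)
  ultimately have "(1 - \<mu> * h) * (norm (x - y) * norm (x - y)) \<le> norm (x - y) * norm ?d"
    by (simp add: algebra_simps power2_eq_square)
  then have "norm (x - y) * ((1 - \<mu> * h) * norm (x - y)) \<le> norm (x - y) * norm ?d"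
    by (simp only: ac_simps)
  then show ?thesis using False by (simp only: mult_le_cancel_left) simp
qed simp

text \<open>Surjectivity supplies a solution, and uniqueness makes the definite description denote
  it.\<close>

lemma implicit_solution_eq:
  fixes f :: "real^'n \<Rightarrow> real^'n"
  assumes osl: "\<And>x y. (x - y) \<bullet> (f x - f y) \<le> \<mu> * (norm (x - y))\<^sup>2"
    and cont: "continuous_on UNIV f" and h: "0 \<le> h" "\<mu> * h < 1"
  shows "implicit_solution f h z = z + h *\<^sub>R f (implicit_solution f h z)"
proof -
  have "surj (\<lambda>x. x - h *\<^sub>R f x)"
    using h one_sided_lipschitz_expansive[OF osl h(1)]
    by (intro expansive_continuous_surj[where c = "1 - \<mu> * h"] continuous_intros cont) auto
  then obtain y where "z = y - h *\<^sub>R f y" by (rule surjE)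
  then have y: "y = z + h *\<^sub>R f y" by simp
  then show ?thesis
    unfolding implicit_solution_def
    by (rule theI) (rule implicit_solution_unique[OF osl h _ y])
qed

text \<open>Expansiveness of a map, read for its inverse, is a Lipschitz bound. Continuity is what
  later makes the implicit iterates measurable.\<close>

lemma continuous_on_implicit_solution:
  fixes f :: "real^'n \<Rightarrow> real^'n"
  assumes osl: "\<And>x y. (x - y) \<bullet> (f x - f y) \<le> \<mu> * (norm (x - y))\<^sup>2"
    and cont: "continuous_on UNIV f" and h: "0 \<le> h" "\<mu> * h < 1"
  shows "continuous_on UNIV (implicit_solution f h)"
proof (rule lipschitz_on_continuous_on, rule lipschitz_onI)
  fix z z' :: "real^'n"
  let ?y = "implicit_solution f h z" and ?y' = "implicit_solution f h z'"
  have "?y - h *\<^sub>R f ?y = z" "?y' - h *\<^sub>R f ?y' = z'"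
    using implicit_solution_eq[OF osl cont h] by (metis add_diff_cancel_right')+
  with one_sided_lipschitz_expansive[OF osl h(1), of ?y ?y']
  have "(1 - \<mu> * h) * norm (?y - ?y') \<le> norm (z - z')" by simp
  then show "dist ?y ?y' \<le> 1 / (1 - \<mu> * h) * dist z z'"
    using h by (simp add: dist_norm field_simps)
qed (use h in simp)

text \<open>The derivative of \<open>h\<close> need not be continuous, so \<open>L1 g h\<close> is
  obtained as a pointwise limit of measurable difference quotients along the direction
  \<open>g x\<close>.\<close>

lemma L1_borel_measurable:
  fixes g h :: "real^'n \<Rightarrow> real^'n"
  assumes diff: "\<And>x. h differentiable (at x)" and g: "g \<in> borel_measurable borel"
  shows "L1 g h \<in> borel_measurable borel"
proof (rule borel_measurable_LIMSEQ_metric)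
  have h: "h \<in> borel_measurable borel"
    using diff by (intro borel_measurable_continuous_onI)
      (simp add: continuous_on_eq_continuous_at differentiable_imp_continuous_within)
  note [measurable] = g h
  show "(\<lambda>x. (h (x + (1 / real (Suc n)) *\<^sub>R g x) - h x) /\<^sub>R (1 / real (Suc n)))
      \<in> borel_measurable borel" for n
    by measurable
  show "(\<lambda>n. (h (x + (1 / real (Suc n)) *\<^sub>R g x) - h x) /\<^sub>R (1 / real (Suc n))) \<longlonglongrightarrow> L1 g h x"
    for x
  proof -
    let ?D = "frechet_derivative h (at x)" and ?q = "\<lambda>t. (h (x + t *\<^sub>R g x) - h x) /\<^sub>R t"
    have "((\<lambda>t. x + t *\<^sub>R g x) has_derivative (\<lambda>t. t *\<^sub>R g x)) (at 0)"
      by (auto intro!: derivative_eq_intros)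
    moreover have "(h has_derivative ?D) (at (x + 0 *\<^sub>R g x))"
      using frechet_derivative_works[THEN iffD1, OF diff] by simp
    ultimately have "((\<lambda>t. h (x + t *\<^sub>R g x)) has_derivative (\<lambda>t. ?D (t *\<^sub>R g x))) (at 0)"
      by (rule has_derivative_compose)
    moreover have "?D (t *\<^sub>R g x) = t *\<^sub>R L1 g h x" for t
      using linear_frechet_derivative[OF diff] by (simp add: L1_def linear_scale)
    ultimately have "(\<lambda>t. norm (h (x + t *\<^sub>R g x) - h x - t *\<^sub>R L1 g h x) / norm t) \<midarrow>0\<rightarrow> 0"
      by (simp add: has_derivative_at)
    then have "(\<lambda>t. norm (?q t - L1 g h x)) \<midarrow>0\<rightarrow> 0"
    proof (rule Lim_transform_eventually)
      have "norm (h (x + t *\<^sub>R g x) - h x - t *\<^sub>R L1 g h x) / norm t = norm (?q t - L1 g h x)"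
        if "t \<noteq> 0" for t
      proof -
        have "?q t - L1 g h x = (h (x + t *\<^sub>R g x) - h x - t *\<^sub>R L1 g h x) /\<^sub>R t"
          using that by (simp add: scaleR_diff_right)
        then show ?thesis by (simp add: divide_inverse_commute)
      qed
      then show "\<forall>\<^sub>F t in at 0. norm (h (x + t *\<^sub>R g x) - h x - t *\<^sub>R L1 g h x) / norm t
          = norm (?q t - L1 g h x)"
        by (auto simp: eventually_at_filter)
    qed
    then have "?q \<midarrow>0\<rightarrow> L1 g h x"
      by (rule LIM_zero_cancel[OF tendsto_norm_zero_cancel])
    moreover have "filterlim (\<lambda>n. 1 / real (Suc n)) (at 0) sequentially"
      by (rule filterlim_atI[OF LIMSEQ_Suc[OF lim_1_over_n]]) simp
    ultimately show ?thesis
      by (rule filterlim_compose)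
  qed
qed

section \<open>One step of the scheme\<close>

text \<open>The square is a quartic polynomial in the Gaussian increment. Odd moments vanish, and
  \<open>(d\<^sup>2 - \<Delta>) / 2\<close> is centred with variance
  \<open>\<Delta>\<^sup>2 / 2\<close>, so no mixed inner products survive.\<close>

lemma nn_integral_normal_milstein:
  fixes a b c :: "'v::real_inner"
  assumes "0 < \<Delta>"
  shows "(\<integral>\<^sup>+d. ennreal (normal_density 0 (sqrt \<Delta>) d) *
      ennreal ((norm (a + d *\<^sub>R b + ((1 / 2) * (\<bar>d\<bar>\<^sup>2 - \<Delta>)) *\<^sub>R c))\<^sup>2) \<partial>lborel)
    = ennreal ((norm a)\<^sup>2 + \<Delta> * (norm b)\<^sup>2 + \<Delta>\<^sup>2 / 2 * (norm c)\<^sup>2)"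
proof -
  let ?p = "normal_density 0 (sqrt \<Delta>)"
  have s: "0 < sqrt \<Delta>" using assms by simp
  have m0: "has_bochner_integral lborel (\<lambda>d. ?p d) 1"
    using normal_moment_even[OF s, of 0 0] by simp
  have m1: "has_bochner_integral lborel (\<lambda>d. ?p d * d) 0"
    using normal_moment_odd[OF s, of 0 0] by simp
  have m2: "has_bochner_integral lborel (\<lambda>d. ?p d * d ^ 2) \<Delta>"
    using normal_moment_even[OF s, of 0 1] assms by (simp add: fact_numeral)
  have m3: "has_bochner_integral lborel (\<lambda>d. ?p d * d ^ 3) 0"
    using normal_moment_odd[OF s, of 0 1] by (simp add: numeral_3_eq_3)
  have m4: "has_bochner_integral lborel (\<lambda>d. ?p d * d ^ 4) (3 * \<Delta>\<^sup>2)"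
    using normal_moment_even[OF s, of 0 2] assms by (simp add: fact_numeral power2_eq_square)
  \<comment> \<open>Coefficients of the powers of \<open>d\<close>. The multiples of
    \<open>a \<bullet> c\<close> in \<open>?q0\<close> and \<open>?q2\<close> cancel on averaging
    because \<open>d\<^sup>2\<close> has mean \<open>\<Delta>\<close>.\<close>
  let ?q0 = "(norm a)\<^sup>2 - \<Delta> * (a \<bullet> c) + \<Delta>\<^sup>2 / 4 * (norm c)\<^sup>2"
  let ?q1 = "2 * (a \<bullet> b) - \<Delta> * (b \<bullet> c)"
  let ?q2 = "(norm b)\<^sup>2 + a \<bullet> c - \<Delta> / 2 * (norm c)\<^sup>2"
  let ?q3 = "b \<bullet> c"
  let ?q4 = "(norm c)\<^sup>2 / 4"
  have expand: "(norm (a + d *\<^sub>R b + ((1 / 2) * (\<bar>d\<bar>\<^sup>2 - \<Delta>)) *\<^sub>R c))\<^sup>2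
      = ?q0 + ?q1 * d + ?q2 * d ^ 2 + ?q3 * d ^ 3 + ?q4 * d ^ 4" for d
    unfolding power2_norm_eq_inner
    by (simp add: inner_add_left inner_add_right inner_commute[of b a] inner_commute[of c a]
        inner_commute[of c b] field_simps power2_eq_square power3_eq_cube power4_eq_xxxx)
  have "has_bochner_integral lborel
     (\<lambda>d. ?p d * ?q0 + ?p d * d * ?q1 + ?p d * d ^ 2 * ?q2 + ?p d * d ^ 3 * ?q3 + ?p d * d ^ 4 * ?q4)
     (1 * ?q0 + 0 * ?q1 + \<Delta> * ?q2 + 0 * ?q3 + 3 * \<Delta>\<^sup>2 * ?q4)"
    by (intro has_bochner_integral_add has_bochner_integral_mult_left m0 m1 m2 m3 m4)
  also have "(\<lambda>d. ?p d * ?q0 + ?p d * d * ?q1 + ?p d * d ^ 2 * ?q2 + ?p d * d ^ 3 * ?q3 + ?p d * d ^ 4 * ?q4)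
    = (\<lambda>d. ?p d * (norm (a + d *\<^sub>R b + ((1 / 2) * (\<bar>d\<bar>\<^sup>2 - \<Delta>)) *\<^sub>R c))\<^sup>2)"
    unfolding expand by (simp add: algebra_simps)
  also have "1 * ?q0 + 0 * ?q1 + \<Delta> * ?q2 + 0 * ?q3 + 3 * \<Delta>\<^sup>2 * ?q4
    = (norm a)\<^sup>2 + \<Delta> * (norm b)\<^sup>2 + \<Delta>\<^sup>2 / 2 * (norm c)\<^sup>2"
    by (simp add: field_simps power2_eq_square)
  finally have "has_bochner_integral lborel
      (\<lambda>d. ?p d * (norm (a + d *\<^sub>R b + ((1 / 2) * (\<bar>d\<bar>\<^sup>2 - \<Delta>)) *\<^sub>R c))\<^sup>2)
      ((norm a)\<^sup>2 + \<Delta> * (norm b)\<^sup>2 + \<Delta>\<^sup>2 / 2 * (norm c)\<^sup>2)" .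
  then have "(\<integral>\<^sup>+d. ennreal (?p d * (norm (a + d *\<^sub>R b + ((1 / 2) * (\<bar>d\<bar>\<^sup>2 - \<Delta>)) *\<^sub>R c))\<^sup>2) \<partial>lborel)
    = ennreal ((norm a)\<^sup>2 + \<Delta> * (norm b)\<^sup>2 + \<Delta>\<^sup>2 / 2 * (norm c)\<^sup>2)"
    by (simp add: has_bochner_integral_iff nn_integral_eq_integral)
  then show ?thesis by (simp add: ennreal_mult')
qed

lemma measurable_milstein_step:
  fixes a b c :: "real^'n \<Rightarrow> real^'n"
  assumes [measurable]: "Z \<in> borel_measurable N" "D \<in> borel_measurable N"
    "a \<in> borel_measurable borel" "b \<in> borel_measurable borel" "c \<in> borel_measurable borel"
  shows "(\<lambda>\<omega>. a (Z \<omega>) + D \<omega> *\<^sub>R b (Z \<omega>) + ((1 / 2) * (\<bar>D \<omega>\<bar>\<^sup>2 - \<Delta>)) *\<^sub>R c (Z \<omega>))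
    \<in> borel_measurable N"
  by measurable

section \<open>Independence of the Brownian increment from the past and averaging over it\<close>

context brownian_motion
begin

lemma subalgebra_F_mono:
  assumes "0 \<le> s" "s \<le> t"
  shows "subalgebra (F t) (F s)"
  using F_mono[OF assms] subalgebra_F[of s] subalgebra_F[of t] assms
  by (auto simp: subalgebra_def)

text \<open>Independence in product-law form, as Tonelli requires it. Equality is checked on
  rectangles, where preimages under \<open>Z\<close> lie in \<open>F s\<close>.\<close>

lemma distr_pair_increment:
  assumes st: "0 \<le> s" "s < t" and Z: "Z \<in> measurable (F s) N"
  shows "distr M N Z \<Otimes>\<^sub>M distr M borel (\<lambda>\<omega>. w t \<omega> - w s \<omega>)
    = distr M (N \<Otimes>\<^sub>M borel) (\<lambda>\<omega>. (Z \<omega>, w t \<omega> - w s \<omega>))"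
proof (rule pair_measure_eqI)
  let ?D = "\<lambda>\<omega>. w t \<omega> - w s \<omega>"
  have sub: "subalgebra M (F s)" using st subalgebra_F by simp
  have [measurable]: "?D \<in> borel_measurable M"
    using gaussian_increments[OF st] by (simp add: distributed_def)
  have [measurable]: "Z \<in> measurable M N"
    using measurable_from_subalg[OF sub Z] .
  show "sigma_finite_measure (distr M N Z)" "sigma_finite_measure (distr M borel ?D)"
    by (intro prob_space_imp_sigma_finite prob_space_distr; simp)+
  show "sets (distr M N Z \<Otimes>\<^sub>M distr M borel ?D) = sets (distr M (N \<Otimes>\<^sub>M borel) (\<lambda>\<omega>. (Z \<omega>, ?D \<omega>)))"
    by (simp cong: sets_pair_measure_cong)
  fix A B assume "A \<in> sets (distr M N Z)" "B \<in> sets (distr M borel ?D)"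
  then have [measurable]: "A \<in> sets N" "B \<in> sets borel" by simp_all
  have "prob ((Z -` A \<inter> space M) \<inter> (?D -` B \<inter> space M))
      = prob (Z -` A \<inter> space M) * prob (?D -` B \<inter> space M)"
    using measurable_sets[OF Z, of A] sub
    by (intro indep_setD[OF independent_increments[OF st]]) (auto simp: subalgebra_def)
  moreover have "(Z -` A \<inter> space M) \<inter> (?D -` B \<inter> space M) = (\<lambda>\<omega>. (Z \<omega>, ?D \<omega>)) -` (A \<times> B) \<inter> space M"
    by auto
  ultimately show "emeasure (distr M N Z) A * emeasure (distr M borel ?D) B
      = emeasure (distr M (N \<Otimes>\<^sub>M borel) (\<lambda>\<omega>. (Z \<omega>, ?D \<omega>))) (A \<times> B)"
    by (simp add: emeasure_distr emeasure_eq_measure ennreal_mult'[symmetric])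
qed

text \<open>This replaces conditioning on \<open>F s\<close>: under the product law, Tonelli freezes
  \<open>z\<close> and leaves a Gaussian integral in the increment. Nonnegative integrals keep this
  valid before the second moment of \<open>Z\<close> is known to be finite.\<close>

lemma nn_integral_milstein_step:
  fixes a b c :: "real^'n \<Rightarrow> real^'n"
  assumes st: "0 \<le> s" "s < t" and Z: "Z \<in> borel_measurable (F s)"
    and abc [measurable]: "a \<in> borel_measurable borel" "b \<in> borel_measurable borel"
      "c \<in> borel_measurable borel"
  shows "(\<integral>\<^sup>+\<omega>. ennreal ((norm (a (Z \<omega>) + (w t \<omega> - w s \<omega>) *\<^sub>R b (Z \<omega>)
        + ((1 / 2) * (\<bar>w t \<omega> - w s \<omega>\<bar>\<^sup>2 - (t - s))) *\<^sub>R c (Z \<omega>)))\<^sup>2) \<partial>M)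
    = (\<integral>\<^sup>+\<omega>. ennreal ((norm (a (Z \<omega>)))\<^sup>2 + (t - s) * (norm (b (Z \<omega>)))\<^sup>2
        + (t - s)\<^sup>2 / 2 * (norm (c (Z \<omega>)))\<^sup>2) \<partial>M)"
proof -
  let ?D = "\<lambda>\<omega>. w t \<omega> - w s \<omega>"
  let ?\<Phi> = "\<lambda>z d. ennreal ((norm (a z + d *\<^sub>R b z + ((1 / 2) * (\<bar>d\<bar>\<^sup>2 - (t - s))) *\<^sub>R c z))\<^sup>2)"
  have dist: "distributed M lborel ?D (normal_density 0 (sqrt (t - s)))"
    by (rule gaussian_increments[OF st])
  have [measurable]: "Z \<in> borel_measurable M" "?D \<in> borel_measurable M"
    using measurable_from_subalg[OF subalgebra_F Z] st dist by (simp_all add: distributed_def)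
  note pair = distr_pair_increment[OF st Z]
  interpret D: prob_space "distr M borel ?D" by (rule prob_space_distr) simp
  have inner: "(\<integral>\<^sup>+d. ?\<Phi> z d \<partial>distr M borel ?D)
      = ennreal ((norm (a z))\<^sup>2 + (t - s) * (norm (b z))\<^sup>2 + (t - s)\<^sup>2 / 2 * (norm (c z))\<^sup>2)" for z
  proof -
    have "(\<integral>\<^sup>+d. ?\<Phi> z d \<partial>distr M borel ?D) = (\<integral>\<^sup>+\<omega>. ?\<Phi> z (?D \<omega>) \<partial>M)"
      by (subst nn_integral_distr) simp_all
    also have "\<dots> = (\<integral>\<^sup>+d. ennreal (normal_density 0 (sqrt (t - s)) d) * ?\<Phi> z d \<partial>lborel)"
      by (rule distributed_nn_integral[OF dist, symmetric]) simp
    also have "\<dots> = ennreal ((norm (a z))\<^sup>2 + (t - s) * (norm (b z))\<^sup>2 + (t - s)\<^sup>2 / 2 * (norm (c z))\<^sup>2)"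
      by (rule nn_integral_normal_milstein) (use st in simp)
    finally show ?thesis .
  qed
  have "(\<integral>\<^sup>+\<omega>. ?\<Phi> (Z \<omega>) (?D \<omega>) \<partial>M)
      = (\<integral>\<^sup>+p. ?\<Phi> (fst p) (snd p) \<partial>distr M (borel \<Otimes>\<^sub>M borel) (\<lambda>\<omega>. (Z \<omega>, ?D \<omega>)))"
    by (subst nn_integral_distr) simp_all
  also have "\<dots> = (\<integral>\<^sup>+p. ?\<Phi> (fst p) (snd p) \<partial>(distr M borel Z \<Otimes>\<^sub>M distr M borel ?D))"
    by (simp only: pair)
  also have "\<dots> = (\<integral>\<^sup>+z. \<integral>\<^sup>+d. ?\<Phi> z d \<partial>distr M borel ?D \<partial>distr M borel Z)"
    by (subst D.nn_integral_fst[symmetric]) simp_all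
  also have "\<dots> = (\<integral>\<^sup>+\<omega>. ennreal ((norm (a (Z \<omega>)))\<^sup>2 + (t - s) * (norm (b (Z \<omega>)))\<^sup>2
        + (t - s)\<^sup>2 / 2 * (norm (c (Z \<omega>)))\<^sup>2) \<partial>M)"
    unfolding inner by (subst nn_integral_distr) simp_all
  finally show ?thesis .
qed

end

section \<open>Mean-square contraction\<close>

text \<open>All estimates are carried out with nonnegative integrals; a finite bound there gives
  integrability and the real-valued bound at once.\<close>

lemma second_moment_leI:
  assumes [measurable]: "X \<in> borel_measurable M" and b: "0 \<le> b"
    and le: "(\<integral>\<^sup>+\<omega>. ennreal ((norm (X \<omega>))\<^sup>2) \<partial>M) \<le> ennreal b"
  shows "second_moment_le M X b"
proof -
  have int: "integrable M (\<lambda>\<omega>. (norm (X \<omega>))\<^sup>2)"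
    using le by (intro integrableI_bounded) (auto simp: le_less_trans)
  then have "ennreal (\<integral>\<omega>. (norm (X \<omega>))\<^sup>2 \<partial>M) \<le> ennreal b"
    using le by (simp add: nn_integral_eq_integral)
  with int b show ?thesis
    by (simp add: second_moment_le_def ennreal_le_iff)
qed

text \<open>One admissible stepsize is fixed. Local Lipschitz continuity enters as continuity of
  \<open>f\<close>, and \<open>step_less\<close> is the solvability condition of the implicit
  equation.\<close>

locale dissipative_milstein = brownian_motion M F w
  for M :: "'a measure" and F :: "real \<Rightarrow> 'a measure" and w :: "real \<Rightarrow> 'a \<Rightarrow> real" +
  fixes f g :: "real^'n \<Rightarrow> real^'n" and \<gamma> \<sigma> \<mu> \<theta> \<Delta> :: real
  assumes g_diff: "\<And>x. g differentiable (at x)"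
    and f_cont: "continuous_on UNIV f"
    and gamma_pos: "0 < \<gamma>"
    and dissipative: "\<And>x. 2 * (x \<bullet> f x) + (norm (g x))\<^sup>2 \<le> - \<gamma> * (norm x)\<^sup>2"
    and L1g_bound: "\<And>x. (norm (L1 g g x))\<^sup>2 \<le> \<sigma> * (norm x)\<^sup>2"
    and one_sided_lipschitz: "\<And>x y. (x - y) \<bullet> (f x - f y) \<le> \<mu> * (norm (x - y))\<^sup>2"
    and theta: "0 \<le> \<theta>" "\<theta> \<le> 1"
    and step_pos: "0 < \<Delta>"
    and step_less: "\<mu> * (\<theta> * \<Delta>) < 1"
begin

section \<open>Measurability and size of the implicit solution along the scheme\<close>

abbreviation Y :: "real^'n \<Rightarrow> real^'n" where
  "Y \<equiv> implicit_solution f (\<theta> * \<Delta>)"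

lemma theta_step_nonneg: "0 \<le> \<theta> * \<Delta>"
  using theta step_pos by simp

lemma Y_eq: "Y z - (\<theta> * \<Delta>) *\<^sub>R f (Y z) = z"
  using implicit_solution_eq[OF one_sided_lipschitz f_cont theta_step_nonneg step_less]
  by (metis add_diff_cancel_right')

lemma measurable_Y: "Y \<in> borel_measurable borel"
  by (intro borel_measurable_continuous_onI continuous_on_implicit_solution[OF
      one_sided_lipschitz f_cont theta_step_nonneg step_less])

lemma measurable_coefficients:
  "(\<lambda>z. z + \<Delta> *\<^sub>R f (Y z)) \<in> borel_measurable borel"
  "(\<lambda>z. g (Y z)) \<in> borel_measurable borel"
  "(\<lambda>z. L1 g g (Y z)) \<in> borel_measurable borel"
proof -
  have f: "f \<in> borel_measurable borel"
    using f_cont by (rule borel_measurable_continuous_onI)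
  have g: "g \<in> borel_measurable borel"
    using g_diff by (intro borel_measurable_continuous_onI)
      (simp add: continuous_on_eq_continuous_at differentiable_imp_continuous_within)
  show "(\<lambda>z. z + \<Delta> *\<^sub>R f (Y z)) \<in> borel_measurable borel"
    by (intro borel_measurable_add borel_measurable_scaleR measurable_ident_sets
        borel_measurable_const measurable_compose[OF measurable_Y f] refl)
  show "(\<lambda>z. g (Y z)) \<in> borel_measurable borel"
    by (rule measurable_compose[OF measurable_Y g])
  show "(\<lambda>z. L1 g g (Y z)) \<in> borel_measurable borel"
    by (rule measurable_compose[OF measurable_Y L1_borel_measurable[OF g_diff g]])
qed

text \<open>Adaptedness is what makes the current iterate independent of the next increment.\<close>

lemma sstm_measurable_F:
  "sstm f g \<theta> x0 w \<Delta> k \<in> borel_measurable (F (real k * \<Delta>))"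
proof (induction k)
  case 0
  then show ?case by simp
next
  case (Suc k)
  let ?s = "real k * \<Delta>" and ?t = "real (Suc k) * \<Delta>"
  have st: "0 \<le> ?s" "?s \<le> ?t" "0 \<le> ?t" using step_pos by (auto simp: mult_right_mono)
  note sub = subalgebra_F_mono[OF st(1,2)]
  have "(\<lambda>\<omega>. w ?t \<omega> - w ?s \<omega>) \<in> borel_measurable (F ?t)"
    by (rule borel_measurable_diff[OF adapted[OF st(3)] measurable_from_subalg[OF sub adapted[OF st(1)]]])
  then show ?case
    unfolding sstm.simps Let_def
    by (rule measurable_milstein_step[OF measurable_from_subalg[OF sub Suc] _ measurable_coefficients])
qed

lemma sstm_measurable: "sstm f g \<theta> x0 w \<Delta> k \<in> borel_measurable M"
  using step_pos by (intro measurable_from_subalg[OF subalgebra_F sstm_measurable_F]) simp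

lemma stm_measurable: "stm f g \<theta> x0 w \<Delta> k \<in> borel_measurable M"
  unfolding stm_def by (rule measurable_compose[OF sstm_measurable measurable_Y])

lemma norm_Y_le: "norm (Y z) * (1 + \<theta> * \<Delta> * \<gamma> / 2) \<le> norm z"
proof (cases "Y z = 0")
  case False
  \<comment> \<open>Dropping the nonnegative diffusion term from dissipativity leaves a coercivity
    bound for the drift alone.\<close>
  have "2 * (Y z \<bullet> f (Y z)) \<le> - \<gamma> * (norm (Y z))\<^sup>2"
    using dissipative[of "Y z"] zero_le_power2[of "norm (g (Y z))"] by linarith
  from mult_left_mono[OF this theta_step_nonneg]
  have "(norm (Y z))\<^sup>2 * (1 + \<theta> * \<Delta> * \<gamma> / 2) \<le> (norm (Y z))\<^sup>2 - \<theta> * \<Delta> * (Y z \<bullet> f (Y z))"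
    by (simp add: algebra_simps)
  also have "\<dots> = Y z \<bullet> (Y z - (\<theta> * \<Delta>) *\<^sub>R f (Y z))"
    by (simp add: inner_diff_right power2_norm_eq_inner)
  also have "\<dots> = Y z \<bullet> z" by (simp only: Y_eq)
  also have "\<dots> \<le> norm (Y z) * norm z" by (rule norm_cauchy_schwarz)
  finally have "norm (Y z) * (norm (Y z) * (1 + \<theta> * \<Delta> * \<gamma> / 2)) \<le> norm (Y z) * norm z"
    by (simp add: power2_eq_square mult.assoc)
  then show ?thesis using False by (simp only: mult_le_cancel_left) simp
qed simp

text \<open>The two drift vectors differ by \<open>\<Delta> *\<^sub>R f y\<close>, and
  \<open>(1 - \<theta>)\<^sup>2 - \<theta>\<^sup>2 = 1 - 2 * \<theta>\<close>. The cross term is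
  exactly \<open>2 * \<Delta> * (y \<bullet> f y)\<close> for every \<open>\<theta>\<close>, so it
  combines with the diffusion term into the dissipativity expression.\<close>

lemma step_energy:
  "(norm (y + ((1 - \<theta>) * \<Delta>) *\<^sub>R f y))\<^sup>2 + \<Delta> * (norm (g y))\<^sup>2 + \<Delta>\<^sup>2 / 2 * (norm (L1 g g y))\<^sup>2
    \<le> (norm (y - (\<theta> * \<Delta>) *\<^sub>R f y))\<^sup>2 - (\<gamma> - 0.5 * \<sigma> * \<Delta>) * \<Delta> * (norm y)\<^sup>2
      + (1 - 2 * \<theta>) * \<Delta>\<^sup>2 * (norm (f y))\<^sup>2"
proof -
  have "(norm (y + ((1 - \<theta>) * \<Delta>) *\<^sub>R f y))\<^sup>2 =
      (norm (y - (\<theta> * \<Delta>) *\<^sub>R f y))\<^sup>2 + \<Delta> * (2 * (y \<bullet> f y)) + (1 - 2 * \<theta>) * \<Delta>\<^sup>2 * (norm (f y))\<^sup>2"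
    unfolding power2_norm_eq_inner
    by (simp add: inner_add_left inner_add_right inner_diff_left inner_diff_right
        inner_commute[of "f y" y] algebra_simps power2_eq_square)
  moreover have "\<Delta> * (2 * (y \<bullet> f y) + (norm (g y))\<^sup>2) \<le> \<Delta> * (- \<gamma> * (norm y)\<^sup>2)"
    using dissipative step_pos by (intro mult_left_mono) auto
  moreover have "\<Delta>\<^sup>2 / 2 * (norm (L1 g g y))\<^sup>2 \<le> \<Delta>\<^sup>2 / 2 * (\<sigma> * (norm y)\<^sup>2)"
    using L1g_bound by (intro mult_left_mono) auto
  ultimately show ?thesis
    by (simp add: algebra_simps power2_eq_square)
qed

text \<open>The interface between probability and algebra: the iteration needs only this pointwise
  inequality, which is then verified separately for each decay factor.\<close>

definition contracts :: "real \<Rightarrow> bool" where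
  "contracts \<rho> \<longleftrightarrow> (\<forall>y. (norm (y - (\<theta> * \<Delta>) *\<^sub>R f y))\<^sup>2 - (\<gamma> - 0.5 * \<sigma> * \<Delta>) * \<Delta> * (norm y)\<^sup>2
      + (1 - 2 * \<theta>) * \<Delta>\<^sup>2 * (norm (f y))\<^sup>2 \<le> \<rho> * (norm (y - (\<theta> * \<Delta>) *\<^sub>R f y))\<^sup>2)"

text \<open>The left side of \<open>step_energy\<close> is a sum of nonnegative terms, so evaluating
  at a nonzero \<open>z\<close> forces the sign of the factor without inspecting its
  formula.\<close>

lemma contracts_nonneg:
  assumes "contracts \<rho>"
  shows "0 \<le> \<rho>"
proof -
  obtain z :: "real^'n" where z: "z \<noteq> 0"
    using zero_neq_one by metis
  have "0 \<le> (norm (Y z + ((1 - \<theta>) * \<Delta>) *\<^sub>R f (Y z)))\<^sup>2 + \<Delta> * (norm (g (Y z)))\<^sup>2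
      + \<Delta>\<^sup>2 / 2 * (norm (L1 g g (Y z)))\<^sup>2"
    using step_pos by (intro add_nonneg_nonneg mult_nonneg_nonneg) auto
  also note step_energy[of "Y z", unfolded Y_eq]
  also have "(norm z)\<^sup>2 - (\<gamma> - 0.5 * \<sigma> * \<Delta>) * \<Delta> * (norm (Y z))\<^sup>2
      + (1 - 2 * \<theta>) * \<Delta>\<^sup>2 * (norm (f (Y z)))\<^sup>2 \<le> \<rho> * (norm z)\<^sup>2"
    using assms[unfolded contracts_def, rule_format, of "Y z"] unfolding Y_eq .
  finally show ?thesis using z by (simp add: zero_le_mult_iff)
qed

text \<open>Induction on \<open>k\<close>: the averaged step is contracted pointwise, and the
  initial value is deterministic.\<close>

lemma nn_integral_sstm_le:
  assumes "contracts \<rho>"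
  shows "(\<integral>\<^sup>+\<omega>. ennreal ((norm (sstm f g \<theta> x0 w \<Delta> k \<omega>))\<^sup>2) \<partial>M)
    \<le> ennreal (\<rho> ^ k * (norm (x0 - (\<theta> * \<Delta>) *\<^sub>R f x0))\<^sup>2)"
proof (induction k)
  case 0
  then show ?case by (simp add: emeasure_space_1)
next
  case (Suc k)
  let ?Z = "sstm f g \<theta> x0 w \<Delta> k" and ?s = "real k * \<Delta>" and ?t = "real (Suc k) * \<Delta>"
  have st: "0 \<le> ?s" "?s < ?t" and ts: "?t - ?s = \<Delta>"
    using step_pos by (auto simp: algebra_simps)
  note step = nn_integral_milstein_step[OF st sstm_measurable_F,
      where a = "\<lambda>z. z + \<Delta> *\<^sub>R f (Y z)" and b = "\<lambda>z. g (Y z)" and c = "\<lambda>z. L1 g g (Y z)",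
      unfolded ts]
  have "(\<integral>\<^sup>+\<omega>. ennreal ((norm (sstm f g \<theta> x0 w \<Delta> (Suc k) \<omega>))\<^sup>2) \<partial>M)
      = (\<integral>\<^sup>+\<omega>. ennreal ((norm (?Z \<omega> + \<Delta> *\<^sub>R f (Y (?Z \<omega>))))\<^sup>2 + \<Delta> * (norm (g (Y (?Z \<omega>))))\<^sup>2
        + \<Delta>\<^sup>2 / 2 * (norm (L1 g g (Y (?Z \<omega>))))\<^sup>2) \<partial>M)"
    unfolding sstm.simps Let_def by (rule step[OF measurable_coefficients])
  also have "\<dots> \<le> (\<integral>\<^sup>+\<omega>. ennreal \<rho> * ennreal ((norm (?Z \<omega>))\<^sup>2) \<partial>M)"
  proof (rule nn_integral_mono)
    fix \<omega>
    let ?z = "?Z \<omega>"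
    \<comment> \<open>The explicit drift update is rewritten in terms of the implicit solution, the
      form in which \<open>step_energy\<close> applies.\<close>
    have "Y ?z + ((1 - \<theta>) * \<Delta>) *\<^sub>R f (Y ?z) = (Y ?z - (\<theta> * \<Delta>) *\<^sub>R f (Y ?z)) + \<Delta> *\<^sub>R f (Y ?z)"
      by (simp add: algebra_simps)
    also have "\<dots> = ?z + \<Delta> *\<^sub>R f (Y ?z)" by (simp only: Y_eq)
    finally have eq: "Y ?z + ((1 - \<theta>) * \<Delta>) *\<^sub>R f (Y ?z) = ?z + \<Delta> *\<^sub>R f (Y ?z)" .
    have "(norm (?z + \<Delta> *\<^sub>R f (Y ?z)))\<^sup>2 + \<Delta> * (norm (g (Y ?z)))\<^sup>2
        + \<Delta>\<^sup>2 / 2 * (norm (L1 g g (Y ?z)))\<^sup>2 \<le> \<rho> * (norm ?z)\<^sup>2"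
      using order_trans[OF step_energy[of "Y ?z"]
          assms[unfolded contracts_def, rule_format, of "Y ?z"]]
      unfolding eq Y_eq .
    then show "ennreal ((norm (?z + \<Delta> *\<^sub>R f (Y ?z)))\<^sup>2 + \<Delta> * (norm (g (Y ?z)))\<^sup>2
        + \<Delta>\<^sup>2 / 2 * (norm (L1 g g (Y ?z)))\<^sup>2) \<le> ennreal \<rho> * ennreal ((norm ?z)\<^sup>2)"
      using contracts_nonneg[OF assms] by (simp add: ennreal_mult'[symmetric] ennreal_leI)
  qed
  also have "\<dots> = ennreal \<rho> * (\<integral>\<^sup>+\<omega>. ennreal ((norm (?Z \<omega>))\<^sup>2) \<partial>M)"
    using sstm_measurable by (intro nn_integral_cmult) simp
  also have "\<dots> \<le> ennreal \<rho> * ennreal (\<rho> ^ k * (norm (x0 - (\<theta> * \<Delta>) *\<^sub>R f x0))\<^sup>2)"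
    using Suc by (rule mult_left_mono) simp
  also have "\<dots> = ennreal (\<rho> ^ Suc k * (norm (x0 - (\<theta> * \<Delta>) *\<^sub>R f x0))\<^sup>2)"
    using contracts_nonneg[OF assms] by (simp add: ennreal_mult'[symmetric] mult.assoc)
  finally show ?case .
qed

text \<open>Apart from the decay factor, the stepsize enters only through the initial value
  \<open>x0 - (\<theta> * \<Delta>) *\<^sub>R f x0\<close>, which \<open>\<theta> \<le> 1\<close>
  and \<open>\<Delta> \<le> B\<close> control.\<close>

lemma second_moment_sstm:
  assumes "contracts \<rho>" and "\<Delta> \<le> B"
  shows "second_moment_le M (sstm f g \<theta> x0 w \<Delta> k) ((norm x0 + B * norm (f x0))\<^sup>2 * \<rho> ^ k)"
proof (rule second_moment_leI)
  have "norm (x0 - (\<theta> * \<Delta>) *\<^sub>R f x0) \<le> norm x0 + \<theta> * \<Delta> * norm (f x0)"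
    using theta_step_nonneg by (metis norm_triangle_ineq4 norm_scaleR abs_of_nonneg)
  also have "\<theta> * \<Delta> \<le> B"
    using mult_right_mono[OF theta(2) less_imp_le[OF step_pos]] assms(2) by simp
  finally have "(norm (x0 - (\<theta> * \<Delta>) *\<^sub>R f x0))\<^sup>2 \<le> (norm x0 + B * norm (f x0))\<^sup>2"
    by (simp add: mult_right_mono power_mono)
  with contracts_nonneg[OF assms(1)]
  have "\<rho> ^ k * (norm (x0 - (\<theta> * \<Delta>) *\<^sub>R f x0))\<^sup>2 \<le> (norm x0 + B * norm (f x0))\<^sup>2 * \<rho> ^ k"
    by (simp add: mult.commute[of "\<rho> ^ k"] mult_right_mono)
  with nn_integral_sstm_le[OF assms(1)]
  show "(\<integral>\<^sup>+\<omega>. ennreal ((norm (sstm f g \<theta> x0 w \<Delta> k \<omega>))\<^sup>2) \<partial>M)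
      \<le> ennreal ((norm x0 + B * norm (f x0))\<^sup>2 * \<rho> ^ k)"
    by (meson ennreal_leI order_trans)
qed (use contracts_nonneg[OF assms(1)] sstm_measurable in auto)

text \<open>The gain \<open>1 + \<theta> \<Delta> \<gamma> / 2\<close> in \<open>norm_Y_le\<close> cancels the linear growth of \<open>z\<^sub>0\<close> in
  \<open>\<Delta>\<close>, so this bound is uniform even over unbounded stepsizes.\<close>

lemma second_moment_stm:
  assumes "contracts \<rho>"
  shows "second_moment_le M (stm f g \<theta> x0 w \<Delta> k) ((norm x0 + 2 / \<gamma> * norm (f x0))\<^sup>2 * \<rho> ^ k)"
proof (rule second_moment_leI)
  let ?h = "\<theta> * \<Delta>"
  let ?q = "1 + ?h * \<gamma> / 2" and ?C = "norm x0 + 2 / \<gamma> * norm (f x0)"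
  have q: "0 < ?q"
    using theta_step_nonneg gamma_pos by (simp add: add_pos_nonneg)
  have "norm (x0 - ?h *\<^sub>R f x0) \<le> norm x0 + ?h * norm (f x0)"
    using theta_step_nonneg by (metis norm_triangle_ineq4 norm_scaleR abs_of_nonneg)
  \<comment> \<open>The added nonnegative terms complete the sum to the product
    \<open>?C * ?q\<close>; this is where the coefficient \<open>2 / \<gamma>\<close> in
    \<open>?C\<close> comes from.\<close>
  also have "\<dots> \<le> norm x0 + ?h * norm (f x0) + (2 / \<gamma> * norm (f x0) + ?h * \<gamma> / 2 * norm x0)"
    using theta_step_nonneg gamma_pos by simp
  also have "\<dots> = ?C * ?q"
    using gamma_pos by (simp add: field_simps)
  finally have "norm (x0 - ?h *\<^sub>R f x0) \<le> ?C * ?q" .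
  then have z0: "(norm (x0 - ?h *\<^sub>R f x0))\<^sup>2 \<le> ?C\<^sup>2 * ?q\<^sup>2"
    by (metis norm_ge_zero power_mono power_mult_distrib)
  have Y: "(norm (Y z))\<^sup>2 \<le> (1 / ?q\<^sup>2) * (norm z)\<^sup>2" for z
  proof -
    have "(norm (Y z) * ?q)\<^sup>2 \<le> (norm z)\<^sup>2"
      using norm_Y_le[of z] q by (intro power_mono) auto
    then have "(norm (Y z))\<^sup>2 * ?q\<^sup>2 \<le> (norm z)\<^sup>2"
      by (simp only: power_mult_distrib)
    moreover have "0 < ?q\<^sup>2" using q by (rule zero_less_power)
    ultimately show ?thesis
      by (simp only: times_divide_eq_left mult_1_left pos_le_divide_eq)
  qed
  have "(\<integral>\<^sup>+\<omega>. ennreal ((norm (stm f g \<theta> x0 w \<Delta> k \<omega>))\<^sup>2) \<partial>M)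
      \<le> (\<integral>\<^sup>+\<omega>. ennreal (1 / ?q\<^sup>2) * ennreal ((norm (sstm f g \<theta> x0 w \<Delta> k \<omega>))\<^sup>2) \<partial>M)"
    unfolding stm_def by (intro nn_integral_mono) (use Y in \<open>simp add: ennreal_mult'[symmetric] ennreal_leI\<close>)
  also have "\<dots> = ennreal (1 / ?q\<^sup>2) * (\<integral>\<^sup>+\<omega>. ennreal ((norm (sstm f g \<theta> x0 w \<Delta> k \<omega>))\<^sup>2) \<partial>M)"
    using sstm_measurable by (intro nn_integral_cmult) simp
  also have "\<dots> \<le> ennreal (1 / ?q\<^sup>2) * ennreal (\<rho> ^ k * (norm (x0 - ?h *\<^sub>R f x0))\<^sup>2)"
    using nn_integral_sstm_le[OF assms] by (rule mult_left_mono) simp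
  also have "\<dots> = ennreal (1 / ?q\<^sup>2 * (\<rho> ^ k * (norm (x0 - ?h *\<^sub>R f x0))\<^sup>2))"
    by (rule ennreal_mult'[symmetric]) simp
  also have "\<dots> \<le> ennreal (?C\<^sup>2 * \<rho> ^ k)"
  proof (rule ennreal_leI)
    have "1 / ?q\<^sup>2 * (\<rho> ^ k * (norm (x0 - ?h *\<^sub>R f x0))\<^sup>2) \<le> 1 / ?q\<^sup>2 * (\<rho> ^ k * (?C\<^sup>2 * ?q\<^sup>2))"
      using z0 contracts_nonneg[OF assms] by (intro mult_left_mono) auto
    also have "\<dots> = ?C\<^sup>2 * \<rho> ^ k"
      using q by simp
    finally show "1 / ?q\<^sup>2 * (\<rho> ^ k * (norm (x0 - ?h *\<^sub>R f x0))\<^sup>2) \<le> ?C\<^sup>2 * \<rho> ^ k" .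
  qed
  finally show "(\<integral>\<^sup>+\<omega>. ennreal ((norm (stm f g \<theta> x0 w \<Delta> k \<omega>))\<^sup>2) \<partial>M) \<le> ennreal (?C\<^sup>2 * \<rho> ^ k)" .
qed (use contracts_nonneg[OF assms] stm_measurable in auto)

text \<open>Since \<open>1 - 2 * \<theta> \<ge> 0\<close>, the growth bound absorbs the drift term
  into the loss, leaving a positive multiple of \<open>(norm y)\<^sup>2\<close>. The same bound
  gives \<open>norm ?z \<le> ?r * norm y\<close>, which turns this loss into a multiple of
  \<open>(norm ?z)\<^sup>2\<close>.\<close>

lemma contracts_rho1:
  assumes "\<theta> \<le> 1/2" and K: "0 < K" "\<And>x. (norm (f x))\<^sup>2 \<le> K * (norm x)\<^sup>2"
    and small: "((1 - 2 * \<theta>) * K + 0.5 * \<sigma>) * \<Delta> < \<gamma>"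
  shows "contracts (rho1 \<gamma> \<sigma> K \<theta> \<Delta>)"
  unfolding contracts_def
proof
  fix y
  let ?c = "\<gamma> - (1 - 2 * \<theta>) * K * \<Delta> - 0.5 * \<sigma> * \<Delta>" and ?r = "1 + \<theta> * \<Delta> * sqrt K"
  let ?z = "y - (\<theta> * \<Delta>) *\<^sub>R f y"
  have c: "0 < ?c" using small by (simp add: algebra_simps)
  have r: "0 < ?r" using theta_step_nonneg K(1) by (simp add: add_pos_nonneg)
  have "norm (f y) \<le> sqrt K * norm y"
    using real_sqrt_le_mono[OF K(2)[of y]] by (simp add: real_sqrt_mult)
  then have "\<theta> * \<Delta> * norm (f y) \<le> \<theta> * \<Delta> * (sqrt K * norm y)"
    using theta_step_nonneg by (rule mult_left_mono)
  moreover have "norm ?z \<le> norm y + \<theta> * \<Delta> * norm (f y)"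
    using theta_step_nonneg by (metis norm_triangle_ineq4 norm_scaleR abs_of_nonneg)
  ultimately have "norm ?z \<le> ?r * norm y"
    by (simp add: algebra_simps)
  then have "(norm ?z)\<^sup>2 \<le> ?r\<^sup>2 * (norm y)\<^sup>2"
    by (metis norm_ge_zero power_mono power_mult_distrib)
  then have "(norm ?z)\<^sup>2 / ?r\<^sup>2 \<le> (norm y)\<^sup>2"
    using r by (simp add: field_simps)
  then have "?c * \<Delta> * ((norm ?z)\<^sup>2 / ?r\<^sup>2) \<le> ?c * \<Delta> * (norm y)\<^sup>2"
    using c step_pos by (intro mult_left_mono) auto
  moreover have "(1 - 2 * \<theta>) * \<Delta>\<^sup>2 * (norm (f y))\<^sup>2 \<le> (1 - 2 * \<theta>) * \<Delta>\<^sup>2 * (K * (norm y)\<^sup>2)"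
    using K(2) assms(1) by (intro mult_left_mono) auto
  moreover have "rho1 \<gamma> \<sigma> K \<theta> \<Delta> * (norm ?z)\<^sup>2 = (norm ?z)\<^sup>2 - ?c * \<Delta> * ((norm ?z)\<^sup>2 / ?r\<^sup>2)"
    by (simp add: rho1_def left_diff_distrib)
  ultimately show "(norm ?z)\<^sup>2 - (\<gamma> - 0.5 * \<sigma> * \<Delta>) * \<Delta> * (norm y)\<^sup>2
      + (1 - 2 * \<theta>) * \<Delta>\<^sup>2 * (norm (f y))\<^sup>2 \<le> rho1 \<gamma> \<sigma> K \<theta> \<Delta> * (norm ?z)\<^sup>2"
    by (simp add: algebra_simps power2_eq_square)
qed

text \<open>With \<open>a = (\<gamma> - \<sigma> \<Delta> / 2) \<Delta>\<close> and \<open>b = 2 \<theta> - 1\<close>, Cauchy-Schwarz gives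
  \<open>|y - \<theta> \<Delta> f y|\<^sup>2 \<le> (1 / a + \<theta>\<^sup>2 / b) (a |y|\<^sup>2 + b \<Delta>\<^sup>2 |f y|\<^sup>2)\<close>, and \<open>1 - rho2\<close> is the
  reciprocal of the first factor.\<close>

lemma contracts_rho2:
  assumes "1/2 < \<theta>" and small: "0.5 * \<sigma> * \<Delta> < \<gamma>"
  shows "contracts (rho2 \<gamma> \<sigma> \<theta> \<Delta>)"
  unfolding contracts_def
proof
  fix y
  let ?z = "y - (\<theta> * \<Delta>) *\<^sub>R f y"
  define a b where "a = (\<gamma> - 0.5 * \<sigma> * \<Delta>) * \<Delta>" and "b = 2 * \<theta> - 1"
  have a: "0 < a" and b: "0 < b" using assms step_pos by (auto simp: a_def b_def)
  have ab: "0 < b + a * \<theta>\<^sup>2" using a b by (simp add: add_pos_nonneg)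
  \<comment> \<open>This square is the defect in the weighted Cauchy-Schwarz inequality, multiplied
    through by the denominators \<open>a\<close> and \<open>b\<close>.\<close>
  have "0 \<le> (norm ((a * \<theta>) *\<^sub>R y + (b * \<Delta>) *\<^sub>R f y))\<^sup>2" by simp
  also have "\<dots> = (b + a * \<theta>\<^sup>2) * (a * (norm y)\<^sup>2 + b * \<Delta>\<^sup>2 * (norm (f y))\<^sup>2) - b * a * (norm ?z)\<^sup>2"
    unfolding power2_norm_eq_inner
    by (simp add: inner_add_left inner_add_right inner_diff_left inner_diff_right
        inner_commute[of "f y" y] algebra_simps power2_eq_square)
  finally have "b * a / (b + a * \<theta>\<^sup>2) * (norm ?z)\<^sup>2 \<le> a * (norm y)\<^sup>2 + b * \<Delta>\<^sup>2 * (norm (f y))\<^sup>2"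
    using ab by (simp add: divide_simps) (simp add: algebra_simps)
  moreover have "rho2 \<gamma> \<sigma> \<theta> \<Delta> * (norm ?z)\<^sup>2 = (norm ?z)\<^sup>2 - b * a / (b + a * \<theta>\<^sup>2) * (norm ?z)\<^sup>2"
    by (simp add: rho2_def a_def b_def mult.assoc left_diff_distrib)
  moreover have "(1 - 2 * \<theta>) * \<Delta>\<^sup>2 * (norm (f y))\<^sup>2 = - (b * \<Delta>\<^sup>2 * (norm (f y))\<^sup>2)"
    by (simp add: b_def algebra_simps)
  ultimately show "(norm ?z)\<^sup>2 - (\<gamma> - 0.5 * \<sigma> * \<Delta>) * \<Delta> * (norm y)\<^sup>2
      + (1 - 2 * \<theta>) * \<Delta>\<^sup>2 * (norm (f y))\<^sup>2 \<le> rho2 \<gamma> \<sigma> \<theta> \<Delta> * (norm ?z)\<^sup>2"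
    unfolding a_def[symmetric] by linarith
qed

end

section \<open>Stepsize thresholds\<close>

lemma less_Delta_starD:
  assumes "ereal \<Delta> < Delta_star \<mu> \<theta>" "0 < \<Delta>" "0 \<le> \<theta>"
  shows "\<mu> * (\<theta> * \<Delta>) < 1"
proof (cases "0 < \<theta> \<and> 0 < \<mu>")
  case True
  with assms show ?thesis by (simp add: Delta_star_def field_simps)
next
  case False
  with assms have "\<mu> * (\<theta> * \<Delta>) \<le> 0" by (auto simp: mult_le_0_iff)
  then show ?thesis by simp
qed

text \<open>For \<open>b = 0\<close> the quotient is infinite and the conclusion reduces to
  \<open>0 < a\<close>.\<close>

lemma less_ereal_divideD:
  assumes "ereal \<Delta> < ereal a / ereal b" "0 \<le> b" "0 < a"
  shows "b * \<Delta> < a"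
  using assms by (cases "b = 0") (auto simp: field_simps)

text \<open>A finite threshold is itself the bound; an infinite one leaves the bound to
  \<open>\<Delta>max\<close>.\<close>

lemma uniform_range_bounded:
  obtains B where "\<And>\<Delta>. 0 < \<Delta> \<Longrightarrow> ereal \<Delta> < D \<Longrightarrow> uniform_range D \<Delta>max \<Delta> \<Longrightarrow> \<Delta> \<le> B"
proof (cases D)
  case (real r)
  then show ?thesis by (intro that[of r]) simp
next
  case PInf
  then show ?thesis by (intro that[of \<Delta>max]) (simp add: uniform_range_def)
next
  case MInf
  then show ?thesis by (intro that[of 0]) simp
qed

section \<open>Mean-square decay for both ranges of the implicitness parameter\<close>

theorem theorem5p2:
  fixes f g :: "real^'n \<Rightarrow> real^'n"
    and M :: "'a measure" and F :: "real \<Rightarrow> 'a measure" and w :: "real \<Rightarrow> 'a \<Rightarrow> real"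
    and \<gamma> \<sigma> \<mu> \<theta> \<Delta>max :: real and x0 :: "real^'n"
  assumes brownian: "brownian_motion M F w"
    and zero: "f 0 = 0" "g 0 = 0"
    and g_diff: "\<And>x. g differentiable (at x)"
    and local_lipschitz: "\<And>j::real. 0 < j \<Longrightarrow> \<exists>Kj>0. \<forall>x y. max (norm x) (norm y) \<le> j \<longrightarrow>
          max (norm (f x - f y)) (norm (g x - g y)) \<le> Kj * norm (x - y)"
    and gamma_pos: "0 < \<gamma>"
    and dissipative: "\<And>x. 2 * (x \<bullet> f x) + (norm (g x))\<^sup>2 \<le> - \<gamma> * (norm x)\<^sup>2"
    and L1g_bound: "\<And>x. (norm (L1 g g x))\<^sup>2 \<le> \<sigma> * (norm x)\<^sup>2"
    and one_sided_lipschitz: "\<And>x y. (x - y) \<bullet> (f x - f y) \<le> \<mu> * (norm (x - y))\<^sup>2"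
    and theta: "0 \<le> \<theta>" "\<theta> \<le> 1"
  shows "\<exists>C>0.
    (\<theta> \<le> 1/2 \<longrightarrow>
      (\<forall>K>0. (\<forall>x. (norm (f x))\<^sup>2 \<le> K * (norm x)\<^sup>2) \<longrightarrow>
        (\<forall>\<Delta>>0. ereal \<Delta> < Delta1_star \<gamma> \<sigma> \<mu> K \<theta> \<longrightarrow>
          (\<forall>k\<ge>1.
            (uniform_range (Delta1_star \<gamma> \<sigma> \<mu> K \<theta>) \<Delta>max \<Delta> \<longrightarrow>
               second_moment_le M (sstm f g \<theta> x0 w \<Delta> k) (C * rho1 \<gamma> \<sigma> K \<theta> \<Delta> ^ k)) \<and>
            second_moment_le M (stm f g \<theta> x0 w \<Delta> k) (C * rho1 \<gamma> \<sigma> K \<theta> \<Delta> ^ k))))) \<and>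
    (1/2 < \<theta> \<longrightarrow>
      (\<forall>\<Delta>>0. ereal \<Delta> < Delta2_star \<gamma> \<sigma> \<mu> \<theta> \<longrightarrow>
        (\<forall>k\<ge>1.
          (uniform_range (Delta2_star \<gamma> \<sigma> \<mu> \<theta>) \<Delta>max \<Delta> \<longrightarrow>
             second_moment_le M (sstm f g \<theta> x0 w \<Delta> k) (C * rho2 \<gamma> \<sigma> \<theta> \<Delta> ^ k)) \<and>
          second_moment_le M (stm f g \<theta> x0 w \<Delta> k) (C * rho2 \<gamma> \<sigma> \<theta> \<Delta> ^ k))))"
proof -
  have f_cont: "continuous_on UNIV f"
    unfolding continuous_on_iff
  proof (intro ballI allI impI)
    fix x :: "real^'n" and e :: real assume e: "0 < e"
    \<comment> \<open>The ball of radius \<open>norm x + 1\<close> contains every point within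
      distance 1 of \<open>x\<close>, so one Lipschitz constant serves near
      \<open>x\<close>.\<close>
    obtain L where L: "0 < L" "\<And>u v. max (norm u) (norm v) \<le> norm x + 1 \<Longrightarrow>
        max (norm (f u - f v)) (norm (g u - g v)) \<le> L * norm (u - v)"
      using local_lipschitz[of "norm x + 1"] by (auto simp: add_nonneg_pos)
    show "\<exists>d>0. \<forall>x'\<in>UNIV. dist x' x < d \<longrightarrow> dist (f x') (f x) < e"
    proof (intro exI conjI ballI impI)
      show "0 < min 1 (e / L)" using e L(1) by simp
      fix x' assume d: "dist x' x < min 1 (e / L)"
      then have "norm x' \<le> norm x + 1"
        using norm_triangle_ineq2[of x' x] by (simp add: dist_norm)
      then have "dist (f x') (f x) \<le> L * dist x' x"
        using L(2)[of x' x] by (simp add: dist_norm)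
      also have "\<dots> < e" using d L(1) by (simp add: field_simps)
      finally show "dist (f x') (f x) < e" .
    qed
  qed
  have loc: "dissipative_milstein M F w f g \<gamma> \<sigma> \<mu> \<theta> \<Delta>"
    if "0 < \<Delta>" "ereal \<Delta> < Delta_star \<mu> \<theta>" for \<Delta>
    using brownian g_diff f_cont gamma_pos dissipative L1g_bound one_sided_lipschitz theta that
      less_Delta_starD[OF that(2,1) theta(1)]
    by (simp add: dissipative_milstein_def dissipative_milstein_axioms_def)
  \<comment> \<open>Evaluating at the nonzero all-ones vector forces the sign of
    \<open>\<sigma>\<close>.\<close>
  have sigma: "0 \<le> \<sigma>"
    using order_trans[OF zero_le_power2 L1g_bound[of 1]] by (simp add: zero_le_mult_iff)
  have Kge: "\<gamma>\<^sup>2 / 4 \<le> K" if K: "\<And>x. (norm (f x))\<^sup>2 \<le> K * (norm x)\<^sup>2" for K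
  proof -
    let ?e = "1 :: real^'n"
    have "\<gamma> * (norm ?e)\<^sup>2 \<le> 2 * - (?e \<bullet> f ?e)"
      using dissipative[of ?e] zero_le_power2[of "norm (g ?e)"] by linarith
    also have "- (?e \<bullet> f ?e) \<le> norm ?e * norm (f ?e)"
      using Cauchy_Schwarz_ineq2[of ?e "f ?e"] by linarith
    finally have "\<gamma> * norm ?e \<le> 2 * norm (f ?e)"
      by (simp add: power2_eq_square)
    then have "(\<gamma> * norm ?e)\<^sup>2 \<le> (2 * norm (f ?e))\<^sup>2"
      using gamma_pos by (intro power_mono) auto
    then have "\<gamma>\<^sup>2 * (norm ?e)\<^sup>2 \<le> 4 * (norm (f ?e))\<^sup>2"
      by (simp add: power_mult_distrib)
    also have "\<dots> \<le> 4 * K * (norm ?e)\<^sup>2"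
      using K[of ?e] by simp
    finally show ?thesis by simp
  qed
  \<comment> \<open>\<open>C\<close> is chosen before \<open>K\<close>, so the stepsizes must be
    bounded uniformly in \<open>K\<close>. Below one half, \<open>Kge\<close> keeps the denominator
    of the threshold away from zero.\<close>
  obtain B1 where B1: "\<And>\<Delta> K. \<theta> \<le> 1/2 \<Longrightarrow> 0 < K \<Longrightarrow> (\<And>x. (norm (f x))\<^sup>2 \<le> K * (norm x)\<^sup>2) \<Longrightarrow>
      0 < \<Delta> \<Longrightarrow> ereal \<Delta> < Delta1_star \<gamma> \<sigma> \<mu> K \<theta> \<Longrightarrow>
      uniform_range (Delta1_star \<gamma> \<sigma> \<mu> K \<theta>) \<Delta>max \<Delta> \<Longrightarrow> \<Delta> \<le> B1"
  proof (cases "\<theta> < 1/2")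
    case True
    have "\<Delta> \<le> \<gamma> / ((1 - 2 * \<theta>) * (\<gamma>\<^sup>2 / 4))"
      if K: "0 < K" "\<And>x. (norm (f x))\<^sup>2 \<le> K * (norm x)\<^sup>2" and \<Delta>: "0 < \<Delta>"
        "ereal \<Delta> < Delta1_star \<gamma> \<sigma> \<mu> K \<theta>" for \<Delta> K
    proof -
      have "((1 - 2 * \<theta>) * K + 0.5 * \<sigma>) * \<Delta> < \<gamma>"
        using \<Delta>(2) True K(1) sigma gamma_pos
        by (intro less_ereal_divideD) (auto simp: Delta1_star_def)
      moreover have "(1 - 2 * \<theta>) * (\<gamma>\<^sup>2 / 4) \<le> (1 - 2 * \<theta>) * K + 0.5 * \<sigma>"
        using mult_left_mono[OF Kge[OF K(2)], of "1 - 2 * \<theta>"] True sigma by linarith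
      then have "(1 - 2 * \<theta>) * (\<gamma>\<^sup>2 / 4) * \<Delta> \<le> ((1 - 2 * \<theta>) * K + 0.5 * \<sigma>) * \<Delta>"
        using \<Delta>(1) by (intro mult_right_mono) auto
      ultimately have "\<Delta> * ((1 - 2 * \<theta>) * (\<gamma>\<^sup>2 / 4)) \<le> \<gamma>" by (simp add: mult.commute)
      moreover have "0 < (1 - 2 * \<theta>) * (\<gamma>\<^sup>2 / 4)" using True gamma_pos by simp
      ultimately show ?thesis by (simp only: pos_le_divide_eq)
    qed
    then show ?thesis using that by blast
  next
    case False
    \<comment> \<open>At one half the coefficient of \<open>K\<close> vanishes, so 0 may stand for
      every \<open>K\<close> in the threshold.\<close>
    obtain B where "\<And>\<Delta>. 0 < \<Delta> \<Longrightarrow> ereal \<Delta> < Delta1_star \<gamma> \<sigma> \<mu> 0 \<theta> \<Longrightarrow>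
        uniform_range (Delta1_star \<gamma> \<sigma> \<mu> 0 \<theta>) \<Delta>max \<Delta> \<Longrightarrow> \<Delta> \<le> B"
      using uniform_range_bounded[of "Delta1_star \<gamma> \<sigma> \<mu> 0 \<theta>" \<Delta>max] by blast
    moreover have "Delta1_star \<gamma> \<sigma> \<mu> K \<theta> = Delta1_star \<gamma> \<sigma> \<mu> 0 \<theta>" if "\<theta> \<le> 1/2" for K
    proof -
      have "1 - 2 * \<theta> = 0" using that False by simp
      then show ?thesis by (simp only: Delta1_star_def mult_zero_left)
    qed
    ultimately show ?thesis using that[of B] by metis
  qed
  obtain B2 where B2: "\<And>\<Delta>. 0 < \<Delta> \<Longrightarrow> ereal \<Delta> < Delta2_star \<gamma> \<sigma> \<mu> \<theta> \<Longrightarrow>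
      uniform_range (Delta2_star \<gamma> \<sigma> \<mu> \<theta>) \<Delta>max \<Delta> \<Longrightarrow> \<Delta> \<le> B2"
    using uniform_range_bounded[of "Delta2_star \<gamma> \<sigma> \<mu> \<theta>" \<Delta>max] by blast
  define C1 where "C1 = (norm x0 + max B1 B2 * norm (f x0))\<^sup>2"
  define C2 where "C2 = (norm x0 + 2 / \<gamma> * norm (f x0))\<^sup>2"
  \<comment> \<open>The summands serve the split-step and implicit sequences respectively; the 1
    keeps \<open>C\<close> positive when \<open>x0 = 0\<close>.\<close>
  define C where "C = C1 + C2 + 1"
  have C: "0 < C" "C1 \<le> C" "C2 \<le> C" by (auto simp: C_def C1_def C2_def add_nonneg_pos)
  have weaken: "second_moment_le M X (C * \<rho> ^ k)"
    if "second_moment_le M X (c * \<rho> ^ k)" "c \<le> C" "0 \<le> \<rho>"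
    for X :: "'a \<Rightarrow> real^'n" and c \<rho> k
    using that mult_right_mono[OF that(2) zero_le_power[OF that(3), of k]]
    by (auto simp: second_moment_le_def)
  show ?thesis
  proof (intro exI[of _ C] conjI impI allI)
    show "0 < C" by (rule C(1))
  next
    fix K \<Delta> :: real and k :: nat
    assume th: "\<theta> \<le> 1/2" and K: "0 < K" "\<forall>x. (norm (f x))\<^sup>2 \<le> K * (norm x)\<^sup>2"
      and \<Delta>: "0 < \<Delta>" "ereal \<Delta> < Delta1_star \<gamma> \<sigma> \<mu> K \<theta>"
    interpret S: dissipative_milstein M F w f g \<gamma> \<sigma> \<mu> \<theta> \<Delta>
      using \<Delta> by (intro loc) (auto simp: Delta1_star_def)
    have "((1 - 2 * \<theta>) * K + 0.5 * \<sigma>) * \<Delta> < \<gamma>"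
      using \<Delta>(2) th K(1) sigma gamma_pos
      by (intro less_ereal_divideD) (auto simp: Delta1_star_def)
    then have contr: "S.contracts (rho1 \<gamma> \<sigma> K \<theta> \<Delta>)"
      using S.contracts_rho1 th K by blast
    show "second_moment_le M (stm f g \<theta> x0 w \<Delta> k) (C * rho1 \<gamma> \<sigma> K \<theta> \<Delta> ^ k)"
      using S.second_moment_stm[OF contr] C(3) S.contracts_nonneg[OF contr]
      unfolding C2_def by (rule weaken)
    assume "uniform_range (Delta1_star \<gamma> \<sigma> \<mu> K \<theta>) \<Delta>max \<Delta>"
    then have "\<Delta> \<le> max B1 B2" using B1[OF th K(1) _ \<Delta>] K(2) by (simp add: le_max_iff_disj)
    then show "second_moment_le M (sstm f g \<theta> x0 w \<Delta> k) (C * rho1 \<gamma> \<sigma> K \<theta> \<Delta> ^ k)"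
      using S.second_moment_sstm[OF contr] C(2) S.contracts_nonneg[OF contr]
      unfolding C1_def by (intro weaken)
  next
    fix \<Delta> :: real and k :: nat
    assume th: "1/2 < \<theta>" and \<Delta>: "0 < \<Delta>" "ereal \<Delta> < Delta2_star \<gamma> \<sigma> \<mu> \<theta>"
    interpret S: dissipative_milstein M F w f g \<gamma> \<sigma> \<mu> \<theta> \<Delta>
      using \<Delta> by (intro loc) (auto simp: Delta2_star_def)
    have "\<sigma> * \<Delta> < 2 * \<gamma>"
      using \<Delta>(2) sigma gamma_pos by (intro less_ereal_divideD) (auto simp: Delta2_star_def)
    then have contr: "S.contracts (rho2 \<gamma> \<sigma> \<theta> \<Delta>)"
      by (intro S.contracts_rho2 th) simp
    show "second_moment_le M (stm f g \<theta> x0 w \<Delta> k) (C * rho2 \<gamma> \<sigma> \<theta> \<Delta> ^ k)"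
      using S.second_moment_stm[OF contr] C(3) S.contracts_nonneg[OF contr]
      unfolding C2_def by (rule weaken)
    assume "uniform_range (Delta2_star \<gamma> \<sigma> \<mu> \<theta>) \<Delta>max \<Delta>"
    then have "\<Delta> \<le> max B1 B2" using B2[OF \<Delta>] by (simp add: le_max_iff_disj)
    then show "second_moment_le M (sstm f g \<theta> x0 w \<Delta> k) (C * rho2 \<gamma> \<sigma> \<theta> \<Delta> ^ k)"
      using S.second_moment_sstm[OF contr] C(2) S.contracts_nonneg[OF contr]
      unfolding C1_def by (intro weaken)
  qed
qed

end
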